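(* Let $f:\mathbb{R}^m\to(-\infty,+\infty]$ and $g:\mathbb{R}^n\to(-\infty,+\infty]$ be proper lower semicontinuous convex functions, $A\in\mathbb{R}^{n\times m}$ of full column rank, and let $R,S\in\mathbb{R}^{n\times n}$ be symmetric positive definite with $A^TRA$ symmetric positive definite. Put $L(x,y)=f(x)+\langle Ax,y\rangle-g(y)$ and let $(x^*,y^* )$ be a saddle point of $L$. Let $(\tau_k)_{k\ge0}$ and $(\lambda_k)_{k\ge0}$ be nondecreasing sequences of positive numbers with $R-\tau_k\lambda_kS^{-1}\succ0$ for all $k$, and suppose there are constants $\overline\tau,\overline\lambda$ with $\tau_k\le\overline\tau$, $\lambda_k\le\overline\lambda$ for all $k$ and $R-\overline\tau\,\overline\lambda S^{-1}\succ0$. Let $(x^{k+1},y^{k+1},\overline y^{k+1})_{k\ge0}$ be an inexact primal-dual sequence (defined in the context) with tolerances $\varepsilon_k,\delta_k\ge0$ ($k\ge 1$) and starting point $(x^0,\overline y^0)$, and for $N\ge1$ put $\widehat x^N=\frac1N\sum_{k=0}^{N-1}x^{k+1}$, $\widehat y^N=\frac1N\sum_{k=0}^{N-1}y^{k+1}$. Suppose that the partial sums $$A_N:=\sum_{k=0}^{N-1}\tau_N\sqrt{\frac{\varepsilon_{k+1}}{\tau_k}}\qquad\text{and}\qquad B_N:=\sum_{k=0}^{N-1}\tau_N(2\varepsilon_{k+1}+\delta_{k+1})$$ are summable, i.e. remain bounded as $N\to\infty$. If $\alpha>0$ and $\delta_k=\mathcal{O}(k^{-(2\alpha+1)})$,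 $\varepsilon_k=\mathcal{O}(k^{-(2\alpha+1)})$ as $k\to\infty$, then, as $N\to\infty$, $$L(\widehat x^N,y^* )-L(x^*,\widehat y^N)=\begin{cases}\mathcal{O}\left(\frac1N\right), & \alpha>\frac12,\\[2pt] \mathcal{O}\left(\frac{\ln^2N}{N}\right), & \alpha=\frac12,\\[2pt] \mathcal{O}\left(N^{-2\alpha}\right), & \alpha\in(0,\frac12).\end{cases}$$
   Context: For a symmetric positive definite matrix $D$, $\|x\|_D^2=\langle x,Dx\rangle$; $M\succ0$ means that the symmetric matrix $M$ is positive definite. For a proper convex function $h$ and $\varepsilon\ge0$, the $\varepsilon$-subdifferential at $z\in\operatorname{dom}h$ is $\partial_\varepsilon h(z)=\{p: h(x)\ge h(z)+\langle p,x-z\rangle-\varepsilon\ \ \forall x\}$ (it is empty for $z\notin\operatorname{dom} h$). A point $(x^*,y^* )$ with $x^*\in\operatorname{dom}f$, $y^*\in\operatorname{dom}g$ is a saddle point of $L$ if $L(x^*,y)\le L(x^*,y^* )\le L(x,y^* )$ for all $x\in\mathbb{R}^m$, $y\in\mathbb{R}^n$. Inexact primal-dual sequence: given $x^0\in\mathbb{R}^m$, $\overline y^0\in\mathbb{R}^n$, step sizes $\tau_k,\lambda_k>0$ and tolerances $\varepsilon_{k+1},\delta_{k+1}\ge0$, a sequence $(x^{k+1},y^{k+1},\overline y^{k+1})_{k\ge0}$ is called an inexact primal-dual sequence if for every $k\ge0$: (1) $y^{k+1}$ is a type-2 approximation, with precision $\varepsilon_{k+1}/2$, of $\arg\max_y\{L(x^k,y)-\frac1{2\tau_k}\|y-\overline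 y^k\|_S^2\}$, i.e. $\frac1{\tau_k}S(\overline y^k-y^{k+1})+Ax^k\in\partial_{\varepsilon_{k+1}/2}\,g(y^{k+1})$; (2) $x^{k+1}$ is a type-2 approximation, with precision $\delta_{k+1}$, of $\arg\min_x\{L(x,y^{k+1})+\frac1{2\lambda_k}\|A(x-x^k)\|_R^2\}$, i.e. $\frac1{\lambda_k}A^TRA(x^k-x^{k+1})-A^Ty^{k+1}\in\partial_{\delta_{k+1}}f(x^{k+1})$; (3) $\overline y^{k+1}$ is a type-1 approximation, with precision $\varepsilon_{k+1}/2$, of $\arg\max_y\{L(x^{k+1},y)-\frac1{2\tau_k}\|y-\overline y^k\|_S^2\}$, i.e. $0\in\partial_{\varepsilon_{k+1}/2}\,G(\overline y^{k+1})$, where $G(y)=g(y)-\langle Ax^{k+1},y\rangle+\frac1{2\tau_k}\|y-\overline y^k\|_S^2$. *)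

theory Defs
  imports "HOL-Analysis.Analysis" "HOL-Library.Landau_Symbols"
begin

definition edom :: "('a \<Rightarrow> ereal) \<Rightarrow> 'a set" where
  "edom h = {x. h x < \<infinity>}"

definition proper_fun :: "('a \<Rightarrow> ereal) \<Rightarrow> bool" where
  "proper_fun h \<longleftrightarrow> (\<forall>x. h x \<noteq> -\<infinity>) \<and> edom h \<noteq> {}"

definition lsc_fun :: "('a::topological_space \<Rightarrow> ereal) \<Rightarrow> bool" where
  "lsc_fun h \<longleftrightarrow> (\<forall>x. h x \<le> Liminf (at x) h)"

(* Only applied to functions that never take the value -\<infinity>, so the right-hand side is never
   of the form \<infinity> - \<infinity>; the endpoints t = 0, 1 are harmless because 0 * \<infinity> = 0 in ereal. *)
definition convex_fun :: "('a::real_vector \<Rightarrow> ereal) \<Rightarrow> bool" where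
  "convex_fun h \<longleftrightarrow> (\<forall>x y. \<forall>t\<in>{0..1::real}.
     h ((1 - t) *\<^sub>R x + t *\<^sub>R y) \<le> ereal (1 - t) * h x + ereal t * h y)"

definition eps_subdifferential :: "real \<Rightarrow> ('a::real_inner \<Rightarrow> ereal) \<Rightarrow> 'a \<Rightarrow> 'a set" where
  "eps_subdifferential \<epsilon> h z =
     {p. z \<in> edom h \<and> (\<forall>x. h x \<ge> h z + ereal (p \<bullet> (x - z)) - ereal \<epsilon>)}"

definition pos_def_mat :: "real^'n^'n \<Rightarrow> bool" where
  "pos_def_mat M \<longleftrightarrow> transpose M = M \<and> (\<forall>x. x \<noteq> 0 \<longrightarrow> x \<bullet> (M *v x) > 0)"

definition wnorm_sq :: "real^'n^'n \<Rightarrow> real^'n \<Rightarrow> real" where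
  "wnorm_sq D x = x \<bullet> (D *v x)"

(* In ereal \<infinity> - \<infinity> = \<infinity>. This convention never matters below: the statement only evaluates
   the Lagrangian at pairs with x in the domain of f or y in the domain of g. *)
definition lagrangian ::
  "(real^'m \<Rightarrow> ereal) \<Rightarrow> (real^'n \<Rightarrow> ereal) \<Rightarrow> real^'m^'n \<Rightarrow> real^'m \<Rightarrow> real^'n \<Rightarrow> ereal" where
  "lagrangian f g A x y = f x + ereal ((A *v x) \<bullet> y) - g y"

definition saddle_point ::
  "(real^'m \<Rightarrow> ereal) \<Rightarrow> (real^'n \<Rightarrow> ereal) \<Rightarrow> real^'m^'n \<Rightarrow> real^'m \<Rightarrow> real^'n \<Rightarrow> bool" where
  "saddle_point f g A xs ys \<longleftrightarrow> xs \<in> edom f \<and> ys \<in> edom g \<and>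
     (\<forall>x y. lagrangian f g A xs y \<le> lagrangian f g A xs ys \<and>
            lagrangian f g A xs ys \<le> lagrangian f g A x ys)"

(* Negative of the objective maximised in the corrector step. *)
definition corrector_objective ::
  "(real^'n \<Rightarrow> ereal) \<Rightarrow> real^'m^'n \<Rightarrow> real^'n^'n \<Rightarrow> real \<Rightarrow> real^'m \<Rightarrow> real^'n \<Rightarrow> real^'n \<Rightarrow> ereal" where
  "corrector_objective g A S t x yb y =
     g y - ereal ((A *v x) \<bullet> y) + ereal (1 / (2 * t) * wnorm_sq S (y - yb))"

(* The three conditions say, in this order, that y (Suc k) and x (Suc k) are type-2 and
   yb (Suc k) is a type-1 approximation of the respective proximal point. The starting
   point is (x 0, yb 0); the values y 0, eps 0 and del 0 are not used. *)
definition inexact_primal_dual_sequence ::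
  "(real^'m \<Rightarrow> ereal) \<Rightarrow> (real^'n \<Rightarrow> ereal) \<Rightarrow> real^'m^'n \<Rightarrow> real^'n^'n \<Rightarrow> real^'n^'n \<Rightarrow>
   (nat \<Rightarrow> real) \<Rightarrow> (nat \<Rightarrow> real) \<Rightarrow> (nat \<Rightarrow> real) \<Rightarrow> (nat \<Rightarrow> real) \<Rightarrow>
   (nat \<Rightarrow> real^'m) \<Rightarrow> (nat \<Rightarrow> real^'n) \<Rightarrow> (nat \<Rightarrow> real^'n) \<Rightarrow> bool" where
  "inexact_primal_dual_sequence f g A R S tau lam eps del x y yb \<longleftrightarrow> (\<forall>k.
     (1 / tau k) *\<^sub>R (S *v (yb k - y (Suc k))) + A *v x k
        \<in> eps_subdifferential (eps (Suc k) / 2) g (y (Suc k)) \<and>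
     (1 / lam k) *\<^sub>R ((transpose A ** R ** A) *v (x k - x (Suc k))) - transpose A *v y (Suc k)
        \<in> eps_subdifferential (del (Suc k)) f (x (Suc k)) \<and>
     0 \<in> eps_subdifferential (eps (Suc k) / 2)
            (corrector_objective g A S (tau k) (x (Suc k)) (yb k)) (yb (Suc k)))"

(* Mean of the iterates with indices 1, ..., N. *)
definition ergodic_mean :: "(nat \<Rightarrow> 'a::real_vector) \<Rightarrow> nat \<Rightarrow> 'a" where
  "ergodic_mean z N = (1 / real N) *\<^sub>R (\<Sum>k<N. z (Suc k))"

end

theory Submission
  imports Defs "HOL-Real_Asymp.Real_Asymp"
begin

text \<open>Write \<open>a\<^sub>k\<close> for the \<open>S\<close>-distance from \<open>yb k\<close> to \<open>ys\<close>, and \<open>b\<^sub>k\<close> for the \<open>A\<^sup>T R A\<close>-distance from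
  \<open>x k\<close> to \<open>xs\<close>. Adding the three approximate optimality conditions, and absorbing the coupling
  term by the step size condition, shows that the energy \<open>a\<^sub>k\<^sup>2 / (2 tau k) + b\<^sub>k\<^sup>2 / (2 lam k)\<close>
  decreases in step \<open>k\<close> by at least the gap at the new iterate, up to the error
  \<open>2 eps (k + 1) + del (k + 1) + sqrt (eps (k + 1) / tau k) a\<^sub>k\<^sub>+\<^sub>1\<close>. As the step sizes do not decrease, the bounded
  partial sums make both error weights summable; hence the energy stays bounded, the gaps of the
  iterates are summable, and Jensen's inequality gives the rate \<open>1/N\<close>. For \<open>\<alpha> \<le> 1/2\<close> this is
  stronger than the asserted rate.\<close>

section \<open>Extended-real convex functions as real functions on their domains\<close>

lemma proper_edom_ereal:
  assumes "proper_fun h" "z \<in> edom h"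
  shows "h z = ereal (real_of_ereal (h z))"
  using assms by (cases "h z") (auto simp: proper_fun_def edom_def)

text \<open>Gives access to Jensen's inequality over the reals. Values on the domain are finite, so
  the right-hand side of the \<open>ereal\<close> inequality is finite; this also makes the domain
  convex.\<close>

lemma convex_on_real_of_ereal:
  assumes "proper_fun h" "convex_fun h"
  shows "convex_on (edom h) (\<lambda>x. real_of_ereal (h x))"
proof -
  have le: "h ((1 - t) *\<^sub>R x + t *\<^sub>R y)
      \<le> ereal ((1 - t) * real_of_ereal (h x) + t * real_of_ereal (h y))"
    if "x \<in> edom h" "y \<in> edom h" "0 \<le> t" "t \<le> 1" for x y and t :: real
  proof -
    have "h ((1 - t) *\<^sub>R x + t *\<^sub>R y) \<le> ereal (1 - t) * h x + ereal t * h y"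
      using assms(2) that by (auto simp: convex_fun_def)
    also have "\<dots> = ereal (1 - t) * ereal (real_of_ereal (h x)) + ereal t * ereal (real_of_ereal (h y))"
      using proper_edom_ereal[OF assms(1)] that by metis
    finally show ?thesis by simp
  qed
  have mem: "(1 - t) *\<^sub>R x + t *\<^sub>R y \<in> edom h"
    if "x \<in> edom h" "y \<in> edom h" "0 \<le> t" "t \<le> 1" for x y and t :: real
    using le[OF that] by (auto simp: edom_def less_eq_ereal_def)
  show ?thesis
  proof (rule convex_onI)
    show "convex (edom h)"
      using mem by (auto simp: convex_alt)
    fix t :: real and x y assume "0 < t" "t < 1" "x \<in> edom h" "y \<in> edom h"
    then show "real_of_ereal (h ((1 - t) *\<^sub>R x + t *\<^sub>R y))
        \<le> (1 - t) * real_of_ereal (h x) + t * real_of_ereal (h y)"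
      using le[of x y t] proper_edom_ereal[OF assms(1) mem[of x y t]]
      by (metis ereal_less_eq(3) less_eq_real_def)
  qed
qed

lemma convex_on_ergodic_mean:
  assumes "convex_on C h" "\<And>k. z (Suc k) \<in> C" "N \<ge> 1"
  shows "ergodic_mean z N \<in> C" "h (ergodic_mean z N) \<le> (1 / real N) * (\<Sum>k<N. h (z (Suc k)))"
proof -
  have eq: "ergodic_mean z N = (\<Sum>k<N. (1 / real N) *\<^sub>R z (Suc k))"
    by (simp add: ergodic_mean_def scaleR_sum_right)
  have "convex C" using assms(1) by (rule convex_on_imp_convex)
  then show "ergodic_mean z N \<in> C"
    unfolding eq by (rule convex_sum[rotated]) (use assms in auto)
  have "h (\<Sum>k<N. (1 / real N) *\<^sub>R z (Suc k)) \<le> (\<Sum>k<N. (1 / real N) * h (z (Suc k)))"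
    by (rule convex_on_sum) (use assms in \<open>auto simp: lessThan_empty_iff\<close>)
  then show "h (ergodic_mean z N) \<le> (1 / real N) * (\<Sum>k<N. h (z (Suc k)))"
    unfolding eq by (simp add: sum_distrib_left)
qed

lemma eps_subdifferential_real:
  assumes "proper_fun h" "p \<in> eps_subdifferential e h z" "x \<in> edom h"
  shows "real_of_ereal (h z) + p \<bullet> (x - z) - e \<le> real_of_ereal (h x)"
proof -
  have z: "z \<in> edom h" and le: "h x \<ge> h z + ereal (p \<bullet> (x - z)) - ereal e"
    using assms(2) by (auto simp: eps_subdifferential_def)
  show ?thesis
    using le proper_edom_ereal[OF assms(1) z] proper_edom_ereal[OF assms(1,3)]
    by (metis ereal_less_eq(3) ereal_minus(1) plus_ereal.simps(1))
qed

section \<open>Squared norms weighted by symmetric positive definite matrices\<close>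

lemma inner_symmetric_matrix:
  fixes M :: "real^'n^'n"
  assumes "transpose M = M"
  shows "u \<bullet> (M *v v) = v \<bullet> (M *v u)"
  by (metis assms dot_lmul_matrix inner_commute transpose_matrix_vector)

lemma wnorm_sq_add:
  assumes "transpose M = M"
  shows "wnorm_sq M (u + v) = wnorm_sq M u + 2 * (u \<bullet> (M *v v)) + wnorm_sq M v"
  using inner_symmetric_matrix[OF assms, of v u]
  by (simp add: wnorm_sq_def matrix_vector_right_distrib inner_add_left inner_add_right)

lemma wnorm_sq_diff:
  assumes "transpose M = M"
  shows "wnorm_sq M (u - v) = wnorm_sq M u - 2 * (u \<bullet> (M *v v)) + wnorm_sq M v"
  using inner_symmetric_matrix[OF assms, of v u]
  by (simp add: wnorm_sq_def matrix_vector_mult_diff_distrib inner_diff_left inner_diff_right)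

lemma wnorm_sq_scaleR: "wnorm_sq M (c *\<^sub>R u) = c\<^sup>2 * wnorm_sq M u"
  by (simp add: wnorm_sq_def matrix_vector_mult_scaleR power2_eq_square)

lemma wnorm_sq_nonneg: "pos_def_mat M \<Longrightarrow> 0 \<le> wnorm_sq M u"
  by (cases "u = 0") (auto simp: pos_def_mat_def wnorm_sq_def less_imp_le)

lemma pos_def_mat_matrix_inv:
  assumes "pos_def_mat S"
  shows "S *v (matrix_inv S *v u) = u"
proof -
  have "\<forall>x. S *v x = 0 \<longrightarrow> x = 0"
    using assms by (metis inner_zero_right less_irrefl pos_def_mat_def)
  then have "invertible S"
    by (simp add: invertible_left_inverse matrix_left_invertible_ker)
  then have "S ** matrix_inv S = mat 1 \<and> matrix_inv S ** S = mat 1"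
    unfolding invertible_def matrix_inv_def by (rule someI_ex)
  then show ?thesis
    by (simp add: matrix_vector_mul_assoc)
qed

text \<open>Young's inequality for \<open>S\<close> and \<open>S\<^sup>-\<^sup>1\<close>, where the step size condition turns the \<open>S\<^sup>-\<^sup>1\<close> norm into the \<open>R\<close> norm.\<close>

lemma inner_le_wnorm_sq:
  fixes u v :: "real^'n"
  assumes S: "pos_def_mat S" and RS: "pos_def_mat (R - (t * l) *\<^sub>R matrix_inv S)"
    and pos: "t > 0" "l > 0"
  shows "u \<bullet> v \<le> wnorm_sq S v / (2 * t) + wnorm_sq R u / (2 * l)"
proof -
  define w where "w = matrix_inv S *v u"
  have Sw: "S *v w = u" unfolding w_def by (rule pos_def_mat_matrix_inv[OF S])
  have sym: "transpose S = S" using S by (simp add: pos_def_mat_def)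
  \<comment> \<open>Since \<open>S *v w = u\<close>, the cross term of this square is
    \<open>u \<bullet> v\<close>, and its last term contains the \<open>matrix_inv S\<close> norm of
    \<open>u\<close>, which the step size condition bounds.\<close>
  have "0 \<le> wnorm_sq S (v - t *\<^sub>R w)" by (rule wnorm_sq_nonneg[OF S])
  also have "\<dots> = wnorm_sq S v - 2 * t * (u \<bullet> v) + t\<^sup>2 * (u \<bullet> w)"
    unfolding wnorm_sq_diff[OF sym] wnorm_sq_scaleR
    using Sw by (simp add: wnorm_sq_def[of S w] matrix_vector_mult_scaleR inner_commute)
  finally have 1: "2 * t * (u \<bullet> v) \<le> wnorm_sq S v + t * (t * (u \<bullet> w))"
    by (simp add: power2_eq_square)
  have "0 \<le> wnorm_sq (R - (t * l) *\<^sub>R matrix_inv S) u" by (rule wnorm_sq_nonneg[OF RS])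
  then have "t * l * (u \<bullet> w) \<le> wnorm_sq R u"
    by (simp add: wnorm_sq_def w_def matrix_vector_mult_diff_rdistrib inner_diff_right
        flip: scaleR_matrix_vector_assoc)
  then have "t * (u \<bullet> w) \<le> wnorm_sq R u / l"
    using pos by (simp add: pos_le_divide_eq mult_ac)
  then have "t * (t * (u \<bullet> w)) \<le> t * (wnorm_sq R u / l)"
    using pos by (intro mult_left_mono) auto
  with 1 have "2 * t * (u \<bullet> v) \<le> wnorm_sq S v + t * (wnorm_sq R u / l)" by linarith
  then have "u \<bullet> v \<le> (wnorm_sq S v + t * (wnorm_sq R u / l)) / (2 * t)"
    using pos by (simp add: pos_le_divide_eq mult_ac)
  also have "\<dots> = wnorm_sq S v / (2 * t) + wnorm_sq R u / (2 * l)"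
    using pos by (simp add: field_simps)
  finally show ?thesis .
qed

section \<open>Energy decrease in a single primal-dual step\<close>

text \<open>Dividing by \<open>r\<close> bounds \<open>P\<close> below by
  \<open>- e / (2 * r) - r * Q / (2 * t)\<close>, which is largest at
  \<open>r = sqrt (e * t / Q)\<close>. If this point exceeds 1, then \<open>Q \<le> e * t\<close>
  and \<open>r = 1\<close> already gives \<open>- e\<close>; if it is 0, a limit replaces
  it.\<close>

lemma quadratic_lower_bound:
  fixes P Q e t :: real
  assumes nn: "Q \<ge> 0" "e \<ge> 0" and t: "t > 0"
    and le: "\<And>r. 0 < r \<Longrightarrow> r \<le> 1 \<Longrightarrow> - (e / 2) \<le> r * P + r\<^sup>2 * Q / (2 * t)"
  shows "- e - sqrt (e / t) * sqrt Q \<le> P"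
proof -
  consider "Q \<le> e * t" | "e = 0" | "e > 0" "e * t < Q" using nn by force
  then show ?thesis
  proof cases
    case 1
    have "Q / (2 * t) \<le> e / 2" using 1 t by (simp add: field_simps)
    moreover have "0 \<le> sqrt (e / t) * sqrt Q" using nn t by simp
    ultimately show ?thesis using le[of 1] by simp
  next
    case 2
    \<comment> \<open>With \<open>e = 0\<close> no positive \<open>r\<close> is optimal: divide by
      \<open>r\<close> and let it tend to 0.\<close>
    have "((\<lambda>r. - (r * Q / (2 * t))) \<longlongrightarrow> - (0 * Q / (2 * t))) (at_right 0)"
      by (intro tendsto_intros) (use t in auto)
    moreover have "eventually (\<lambda>r. - (r * Q / (2 * t)) \<le> P) (at_right (0::real))"
      unfolding eventually_at_right_field
    proof (intro exI[of _ 1] conjI allI impI)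
      fix r :: real assume r: "0 < r" "r < 1"
      have "0 \<le> r * (P + r * Q / (2 * t))"
        using le[of r] r 2 by (simp add: power2_eq_square algebra_simps)
      then show "- (r * Q / (2 * t)) \<le> P" using r by (simp add: zero_le_mult_iff)
    qed simp
    ultimately have "- (0 * Q / (2 * t)) \<le> P"
      by (rule tendsto_upperbound) simp
    then show ?thesis using 2 by simp
  next
    case 3
    have Q: "Q > 0" using 3 t by (meson less_trans mult_pos_pos)
    \<comment> \<open>The optimal \<open>r\<close>: it makes the quadratic term equal to
      \<open>e / 2\<close>, and \<open>e * t < Q\<close> keeps it below 1.\<close>
    define r where "r = sqrt (e * t) / sqrt Q"
    have r: "0 < r" "r \<le> 1" using 3 t Q by (auto simp: r_def)
    have r2: "r\<^sup>2 = e * t / Q" using nn t Q by (simp add: r_def power_divide)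
    have "r * (sqrt (e / t) * sqrt Q) = e"
      using nn t Q by (simp add: r_def real_sqrt_mult real_sqrt_divide)
    moreover have "- e \<le> r * P" using le[OF r] r2 t Q by (simp add: field_simps)
    ultimately have "0 \<le> r * (P + sqrt (e / t) * sqrt Q)" by (simp add: algebra_simps)
    then have "0 \<le> P + sqrt (e / t) * sqrt Q" using r by (simp add: zero_le_mult_iff)
    then show ?thesis using nn by simp
  qed
qed

text \<open>Testing minimality of \<open>z\<close> at the points \<open>z + r (y - z)\<close> and optimising over \<open>r\<close> replaces
  the usual decomposition of the \<open>\<epsilon>\<close>-subdifferential of a sum.\<close>

lemma corrector_inequality:
  fixes g :: "real^'n \<Rightarrow> ereal"
  defines "G \<equiv> \<lambda>y. real_of_ereal (g y)"
  assumes g: "proper_fun g" "convex_fun g" and S: "pos_def_mat S" and t: "t > 0" and e: "e \<ge> 0"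
    and sub: "0 \<in> eps_subdifferential (e / 2) (corrector_objective g A S t x yb) z"
    and y: "y \<in> edom g"
  shows "z \<in> edom g"
    and "- e - sqrt (e / t) * sqrt (wnorm_sq S (y - z))
      \<le> G y - G z - (A *v x) \<bullet> (y - z)
        + (wnorm_sq S (y - yb) - wnorm_sq S (z - yb) - wnorm_sq S (y - z)) / (2 * t)"
proof -
  have co: "corrector_objective g A S t x yb w
      = ereal (G w - (A *v x) \<bullet> w + wnorm_sq S (w - yb) / (2 * t))" if "w \<in> edom g" for w
    unfolding corrector_objective_def G_def
    by (subst proper_edom_ereal[OF g(1) that]) simp
  show z: "z \<in> edom g"
    using sub by (cases "g z") (auto simp: eps_subdifferential_def edom_def corrector_objective_def)
  have cvx: "convex_on (edom g) G"
    unfolding G_def by (rule convex_on_real_of_ereal[OF g])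
  have sym: "transpose S = S" using S by (simp add: pos_def_mat_def)
  \<comment> \<open>\<open>P\<close> is the coefficient of \<open>r\<close> in the upper bound, by
    convexity of \<open>G\<close>, for the growth of the corrector objective from \<open>z\<close>
    to \<open>z + r (y - z)\<close>.\<close>
  define P where "P = G y - G z - (A *v x) \<bullet> (y - z) + ((y - z) \<bullet> (S *v (z - yb))) / t"
  have "- e - sqrt (e / t) * sqrt (wnorm_sq S (y - z)) \<le> P"
  proof (rule quadratic_lower_bound[OF wnorm_sq_nonneg[OF S] e t])
    fix r :: real assume r: "0 < r" "r \<le> 1"
    define w where "w = (1 - r) *\<^sub>R z + r *\<^sub>R y"
    have w: "w \<in> edom g"
      unfolding w_def using convex_on_imp_convex[OF cvx] z y r by (auto simp: convex_alt)
    have Gw: "G w \<le> (1 - r) * G z + r * G y"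
      unfolding w_def using cvx z y r by (auto simp: convex_on_def)
    have "corrector_objective g A S t x yb z - ereal (e / 2) \<le> corrector_objective g A S t x yb w"
      using sub by (simp add: eps_subdifferential_def zero_ereal_def[symmetric])
    then have "G z - (A *v x) \<bullet> z + wnorm_sq S (z - yb) / (2 * t) - e / 2
        \<le> G w - (A *v x) \<bullet> w + wnorm_sq S (w - yb) / (2 * t)"
      by (simp add: co z w)
    moreover have "(A *v x) \<bullet> w = (A *v x) \<bullet> z + r * ((A *v x) \<bullet> (y - z))"
      by (simp add: w_def algebra_simps inner_simps)
    moreover have "wnorm_sq S (w - yb) / (2 * t) = wnorm_sq S (z - yb) / (2 * t)
        + r * (((y - z) \<bullet> (S *v (z - yb))) / t) + r\<^sup>2 * wnorm_sq S (y - z) / (2 * t)"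
    proof -
      have eq: "w - yb = r *\<^sub>R (y - z) + (z - yb)" by (simp add: w_def algebra_simps)
      show ?thesis
        unfolding eq wnorm_sq_add[OF sym] wnorm_sq_scaleR by (simp add: add_divide_distrib)
    qed
    ultimately show "- (e / 2) \<le> r * P + r\<^sup>2 * wnorm_sq S (y - z) / (2 * t)"
      using Gw by (simp add: P_def algebra_simps)
  qed
  moreover have "wnorm_sq S (y - yb) = wnorm_sq S (y - z) + 2 * ((y - z) \<bullet> (S *v (z - yb)))
      + wnorm_sq S (z - yb)"
    using wnorm_sq_add[OF sym, of "y - z" "z - yb"] by simp
  ultimately show "- e - sqrt (e / t) * sqrt (wnorm_sq S (y - z))
      \<le> G y - G z - (A *v x) \<bullet> (y - z)
        + (wnorm_sq S (y - yb) - wnorm_sq S (z - yb) - wnorm_sq S (y - z)) / (2 * t)"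
    using t by (simp add: P_def)
qed

text \<open>The predictor condition is tested at \<open>yb'\<close>, the primal one at
  \<open>xs\<close>, the corrector at \<open>ys\<close>. In the sum the squares of
  \<open>yb' - yb\<close> cancel, and apart from the gap the coupling leaves only
  \<open>(A *v (x' - x)) \<bullet> (yb' - y')\<close>. Young's inequality pays for it with the
  squares of \<open>yb' - y'\<close> and \<open>x' - x\<close>; the square of \<open>yb - y'\<close>
  is dropped. The errors add up to \<open>3 * e / 2 + d\<close>, which is at most
  \<open>2 * e + d\<close>.\<close>

lemma inexact_primal_dual_step:
  fixes f :: "real^'m \<Rightarrow> ereal" and g :: "real^'n \<Rightarrow> ereal" and A :: "real^'m^'n"
  defines "F \<equiv> \<lambda>x. real_of_ereal (f x)" and "G \<equiv> \<lambda>y. real_of_ereal (g y)"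
  assumes f: "proper_fun f" and g: "proper_fun g" "convex_fun g"
    and R: "pos_def_mat R" and S: "pos_def_mat S"
    and tl: "t > 0" "l > 0" and e: "e \<ge> 0"
    and RS: "pos_def_mat (R - (t * l) *\<^sub>R matrix_inv S)"
    and xs: "xs \<in> edom f" and ys: "ys \<in> edom g"
    and s1: "(1 / t) *\<^sub>R (S *v (yb - y')) + A *v x \<in> eps_subdifferential (e / 2) g y'"
    and s2: "(1 / l) *\<^sub>R ((transpose A ** R ** A) *v (x - x')) - transpose A *v y'
      \<in> eps_subdifferential d f x'"
    and s3: "0 \<in> eps_subdifferential (e / 2) (corrector_objective g A S t x' yb) yb'"
  shows "F x' + (A *v x') \<bullet> ys - G ys - (F xs + (A *v xs) \<bullet> y' - G y')
      + wnorm_sq S (ys - yb') / (2 * t) + wnorm_sq (transpose A ** R ** A) (xs - x') / (2 * l)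
    \<le> wnorm_sq S (ys - yb) / (2 * t) + wnorm_sq (transpose A ** R ** A) (xs - x) / (2 * l)
      + (2 * e + d) + sqrt (e / t) * sqrt (wnorm_sq S (ys - yb'))"
proof -
  define M where "M = transpose A ** R ** A"
  have symS: "transpose S = S" and symR: "transpose R = R"
    using R S by (auto simp: pos_def_mat_def)
  have symM: "transpose M = M"
    by (simp add: M_def matrix_transpose_mul symR matrix_mul_assoc)
  have adj: "(transpose A *v v) \<bullet> u = v \<bullet> (A *v u)" for u v
    by (metis dot_lmul_matrix transpose_matrix_vector)
  \<comment> \<open>This lets Young's inequality, stated with \<open>R\<close>, be applied to
    \<open>A *v (x' - x)\<close>.\<close>
  have M_R: "wnorm_sq M u = wnorm_sq R (A *v u)" for u
    unfolding wnorm_sq_def M_def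
    by (metis adj inner_commute matrix_vector_mul_assoc)
  have cosine: "(D *v (a - b)) \<bullet> (c - b) = (wnorm_sq D (a - b) + wnorm_sq D (c - b) - wnorm_sq D (c - a)) / 2"
    if "transpose D = D" for D :: "real^'k^'k" and a b c
    using wnorm_sq_diff[OF that, of "c - b" "a - b"] by (simp add: inner_commute)
  note c3 = corrector_inequality[OF g S tl(1) e s3 ys]
  have c1: "G y' + ((1 / t) * ((wnorm_sq S (yb - y') + wnorm_sq S (yb' - y') - wnorm_sq S (yb' - yb)) / 2)
      + (A *v x) \<bullet> (yb' - y')) - e / 2 \<le> G yb'"
    using eps_subdifferential_real[OF g(1) s1 c3(1)]
    by (simp add: G_def inner_add_left cosine[OF symS])
  have c2: "F x' + ((1 / l) * ((wnorm_sq M (x - x') + wnorm_sq M (xs - x') - wnorm_sq M (xs - x)) / 2)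
      - y' \<bullet> (A *v (xs - x'))) - d \<le> F xs"
    using eps_subdifferential_real[OF f s2 xs]
    by (simp add: F_def inner_diff_left cosine[OF symM] dot_lmul_matrix flip: M_def)
  have young: "(A *v (x' - x)) \<bullet> (yb' - y') \<le> wnorm_sq S (yb' - y') / (2 * t) + wnorm_sq M (x' - x) / (2 * l)"
    unfolding M_R by (rule inner_le_wnorm_sq[OF S RS tl])
  have flip: "wnorm_sq D (a - b) = wnorm_sq D (b - a)" for D :: "real^'k^'k" and a b
    using wnorm_sq_scaleR[of D "-1" "a - b"] by simp
  have "0 \<le> wnorm_sq S (yb - y') / (2 * t)"
    using wnorm_sq_nonneg[OF S] tl by simp
  then show ?thesis
    using c1 c2 c3(2) young e flip[of S yb' yb] flip[of M x' x]
    unfolding M_def[symmetric]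
    by (simp add: G_def add_divide_distrib diff_divide_distrib matrix_vector_mult_diff_distrib
        inner_diff_left inner_diff_right inner_commute)
qed

section \<open>Bounded energy and summable gaps\<close>

text \<open>The error involves the still uncontrolled \<open>a (Suc k)\<close>. Its running maximum
  \<open>W\<close> satisfies a quadratic inequality \<open>W * W \<le> p + q * W\<close> with
  constants independent of the index, so \<open>a\<close> is bounded; telescoping then bounds the
  sum of \<open>G\<close>.\<close>

lemma energy_recursion_bound:
  fixes E a e s G :: "nat \<Rightarrow> real"
  assumes step: "\<And>k. G k + E (Suc k) \<le> E k + e k + s k * a (Suc k)"
    and nn: "\<And>k. 0 \<le> G k" "\<And>k. 0 \<le> E k" "\<And>k. 0 \<le> s k" "\<And>k. 0 \<le> a k"
    and a: "\<And>k. (a k)\<^sup>2 \<le> c * E k" and c: "c \<ge> 0"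
    and e: "\<And>n. (\<Sum>k<n. e k) \<le> K" and s: "\<And>n. (\<Sum>k<n. s k) \<le> D"
  shows "\<exists>C. \<forall>n. (\<Sum>k<n. G k) \<le> C"
proof -
  have tel: "(\<Sum>k<n. G k) + E n \<le> E 0 + (\<Sum>k<n. e k) + (\<Sum>k<n. s k * a (Suc k))" for n
  proof (induction n)
    case (Suc n)
    then show ?case using step[of n] by simp
  qed simp
  have D: "0 \<le> D" using s[of 0] by simp
  have K: "0 \<le> K" using e[of 0] by simp
  \<comment> \<open>With \<open>p = c * (E 0 + K)\<close> and \<open>q = c * D\<close>, a
    \<open>W > 1\<close> with \<open>W * W \<le> p + q * W\<close> is at most \<open>p + q\<close>;
    the summand 1 covers \<open>W \<le> 1\<close>.\<close>
  define B where "B = 1 + c * (E 0 + K) + c * D"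
  \<comment> \<open>The bound \<open>W\<close> must hold up to index \<open>n\<close> inclusive, as
    the sum over \<open>k < n\<close> reaches \<open>a n\<close>.\<close>
  have tel': "(\<Sum>k<n. G k) + E n \<le> E 0 + K + D * W"
    if "\<And>k. k \<le> n \<Longrightarrow> a k \<le> W" "0 \<le> W" for n W
  proof -
    have "(\<Sum>k<n. s k * a (Suc k)) \<le> (\<Sum>k<n. s k * W)"
      by (intro sum_mono mult_left_mono that nn) auto
    also have "\<dots> \<le> D * W"
      using s[of n] that(2) by (simp add: sum_distrib_right[symmetric] mult_right_mono)
    finally show ?thesis using tel[of n] e[of n] by linarith
  qed
  have aB: "a n \<le> B" for n
  proof -
    define W where "W = Max (a ` {..n})"
    have le: "a k \<le> W" if "k \<le> n" for k unfolding W_def using that by (intro Max_ge) auto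
    have W0: "0 \<le> W" using le[of 0] nn(4)[of 0] by simp
    \<comment> \<open>Stopping the recursion at an index \<open>m\<close> where the maximum is
      attained gives an inequality in \<open>W\<close> alone.\<close>
    have "W \<in> a ` {..n}" unfolding W_def by (intro Max_in) auto
    then obtain m where m: "m \<le> n" "W = a m" by auto
    have "E m \<le> E 0 + K + D * W"
      using tel'[of m W] le m(1) W0 sum_nonneg[of "{..<m}" G] nn(1) by fastforce
    then have "c * E m \<le> c * (E 0 + K + D * W)" using c by (rule mult_left_mono)
    then have W2: "W * W \<le> c * (E 0 + K) + c * D * W"
      using a[of m] m by (simp add: power2_eq_square algebra_simps)
    have p: "0 \<le> c * (E 0 + K)" "0 \<le> c * D" using c nn(2)[of 0] K D by auto
    have "W \<le> B"
    proof (rule ccontr)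
      assume "\<not> W \<le> B"
      then have W: "1 < W" "B < W" using p by (auto simp: B_def)
      have "c * (E 0 + K) * 1 \<le> c * (E 0 + K) * W"
        using W p by (intro mult_left_mono) auto
      then have "W * W \<le> (c * (E 0 + K) + c * D) * W" using W2 by (simp add: algebra_simps)
      then have "W \<le> c * (E 0 + K) + c * D" using W by simp
      then show False using W by (simp add: B_def)
    qed
    then show ?thesis using le[of n] by simp
  qed
  have "0 \<le> B" using aB[of 0] nn(4)[of 0] by simp
  then have "(\<Sum>k<n. G k) \<le> E 0 + K + D * B" for n
    using tel'[of n B] aB nn(2)[of n] by fastforce
  then show ?thesis by blast
qed

text \<open>The weight \<open>t N\<close> varies with the upper limit, but it is at least
  \<open>t 0 > 0\<close>, so dividing the bound by \<open>t 0\<close> removes it.\<close>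

lemma Bseq_weighted_sum_bound:
  fixes t w :: "nat \<Rightarrow> real"
  assumes "Bseq (\<lambda>N. \<Sum>k<N. t N * w k)" "mono t" "\<And>k. t k > 0" "\<And>k. 0 \<le> w k"
  obtains K where "\<And>N. (\<Sum>k<N. w k) \<le> K"
proof -
  obtain B where B: "\<And>N. norm (\<Sum>k<N. t N * w k) \<le> B"
    using assms(1) by (auto simp: Bseq_def)
  have "(\<Sum>k<N. w k) \<le> B / t 0" for N
  proof -
    have "t 0 * (\<Sum>k<N. w k) \<le> t N * (\<Sum>k<N. w k)"
      using assms by (intro mult_right_mono sum_nonneg) (auto simp: monoD)
    also have "\<dots> \<le> B" using B[of N] by (simp add: sum_distrib_left)
    finally show ?thesis using assms(3)[of 0] by (simp add: pos_le_divide_eq mult.commute)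
  qed
  then show ?thesis by (rule that)
qed

section \<open>Rate of the ergodic gap\<close>

theorem theorem3p2:
  fixes f :: "real^'m \<Rightarrow> ereal" and g :: "real^'n \<Rightarrow> ereal"
    and A :: "real^'m^'n" and R S :: "real^'n^'n"
    and xs :: "real^'m" and ys :: "real^'n"
    and tau lam eps del :: "nat \<Rightarrow> real" and taubar lambar \<alpha> :: real
    and x :: "nat \<Rightarrow> real^'m" and y yb :: "nat \<Rightarrow> real^'n"
  defines "gap \<equiv> \<lambda>N. lagrangian f g A (ergodic_mean x N) ys - lagrangian f g A xs (ergodic_mean y N)"
  assumes "proper_fun f" and "lsc_fun f" and "convex_fun f"
    and "proper_fun g" and "lsc_fun g" and "convex_fun g"
    and "rank A = CARD('m)"
    and "pos_def_mat R" and "pos_def_mat S" and "pos_def_mat (transpose A ** R ** A)"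
    and "saddle_point f g A xs ys"
    and "\<And>k. tau k > 0" and "\<And>k. lam k > 0"
    and "mono tau" and "mono lam"
    and "\<And>k. pos_def_mat (R - (tau k * lam k) *\<^sub>R matrix_inv S)"
    and "\<And>k. tau k \<le> taubar" and "\<And>k. lam k \<le> lambar"
    and "pos_def_mat (R - (taubar * lambar) *\<^sub>R matrix_inv S)"
    and "\<And>k. k \<ge> 1 \<Longrightarrow> eps k \<ge> 0" and "\<And>k. k \<ge> 1 \<Longrightarrow> del k \<ge> 0"
    and "inexact_primal_dual_sequence f g A R S tau lam eps del x y yb"
    and "Bseq (\<lambda>N. \<Sum>k<N. tau N * sqrt (eps (Suc k) / tau k))"
    and "Bseq (\<lambda>N. \<Sum>k<N. tau N * (2 * eps (Suc k) + del (Suc k)))"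
    and "\<alpha> > 0"
    and "del \<in> O(\<lambda>k. real k powr (- (2 * \<alpha> + 1)))"
    and "eps \<in> O(\<lambda>k. real k powr (- (2 * \<alpha> + 1)))"
  shows "(\<forall>N\<ge>1. \<bar>gap N\<bar> \<noteq> \<infinity>) \<and>
    (\<alpha> > 1/2 \<longrightarrow> (\<lambda>N. real_of_ereal (gap N)) \<in> O(\<lambda>N. 1 / real N)) \<and>
    (\<alpha> = 1/2 \<longrightarrow> (\<lambda>N. real_of_ereal (gap N)) \<in> O(\<lambda>N. (ln (real N))\<^sup>2 / real N)) \<and>
    (\<alpha> < 1/2 \<longrightarrow> (\<lambda>N. real_of_ereal (gap N)) \<in> O(\<lambda>N. real N powr (- (2 * \<alpha>))))"
proof -
  note f = assms(2,4) and g = assms(5,7) and R = assms(9) and S = assms(10) and M = assms(11)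
    and sad = assms(12) and tau = assms(13) and lam = assms(14) and tau_mono = assms(15)
    and lam_mono = assms(16) and RS = assms(17) and taubar = assms(18)
    and eps = assms(21) and del = assms(22) and seq = assms(23)
  define F where "F = (\<lambda>x. real_of_ereal (f x))"
  define G where "G = (\<lambda>y. real_of_ereal (g y))"
  define L where "L = (\<lambda>x y. F x + (A *v x) \<bullet> y - G y)"
  have L: "lagrangian f g A u v = ereal (L u v)" if "u \<in> edom f" "v \<in> edom g" for u v
    unfolding lagrangian_def L_def F_def G_def
    by (subst proper_edom_ereal[OF f(1) that(1)], subst proper_edom_ereal[OF g(1) that(2)]) simp
  have xs: "xs \<in> edom f" and ys: "ys \<in> edom g"
    using sad by (auto simp: saddle_point_def)
  \<comment> \<open>Both sides are compared with the saddle value. This makes the gaps of the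
    iterates nonnegative, and later the gap at the means.\<close>
  have nonneg: "L xs v \<le> L u ys" if "u \<in> edom f" "v \<in> edom g" for u v
  proof -
    have "lagrangian f g A xs v \<le> lagrangian f g A u ys"
      using sad unfolding saddle_point_def by (meson order_trans)
    then show ?thesis using that xs ys by (simp add: L)
  qed
  have s1: "(1 / tau k) *\<^sub>R (S *v (yb k - y (Suc k))) + A *v x k
        \<in> eps_subdifferential (eps (Suc k) / 2) g (y (Suc k))"
    and s2: "(1 / lam k) *\<^sub>R ((transpose A ** R ** A) *v (x k - x (Suc k))) - transpose A *v y (Suc k)
        \<in> eps_subdifferential (del (Suc k)) f (x (Suc k))"
    and s3: "0 \<in> eps_subdifferential (eps (Suc k) / 2)
            (corrector_objective g A S (tau k) (x (Suc k)) (yb k)) (yb (Suc k))" for k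
    using seq by (auto simp: inexact_primal_dual_sequence_def)
  \<comment> \<open>Only indices from 1 on are covered: the starting point \<open>x 0\<close> may
    lie outside the domain of \<open>f\<close>.\<close>
  have x: "x (Suc k) \<in> edom f" and y: "y (Suc k) \<in> edom g" for k
    using s1[of k] s2[of k] by (auto simp: eps_subdifferential_def)
  define E where "E = (\<lambda>k. wnorm_sq S (ys - yb k) / (2 * tau k)
      + wnorm_sq (transpose A ** R ** A) (xs - x k) / (2 * lam k))"
  define a where "a = (\<lambda>k. sqrt (wnorm_sq S (ys - yb k)))"
  define \<gamma> where "\<gamma> = (\<lambda>k. L (x (Suc k)) ys - L xs (y (Suc k)))"
  define e where "e = (\<lambda>k. 2 * eps (Suc k) + del (Suc k))"
  define s where "s = (\<lambda>k. sqrt (eps (Suc k) / tau k))"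
  have e0: "0 \<le> e k" and s0: "0 \<le> s k" for k
    using eps[of "Suc k"] del[of "Suc k"] tau[of k] by (auto simp: e_def s_def)
  obtain K where K: "\<And>n. (\<Sum>k<n. e k) \<le> K"
    by (rule Bseq_weighted_sum_bound[of tau e]) (use assms(25) tau_mono tau e0 in \<open>auto simp: e_def\<close>)
  obtain D where D: "\<And>n. (\<Sum>k<n. s k) \<le> D"
    by (rule Bseq_weighted_sum_bound[of tau s]) (use assms(24) tau_mono tau s0 in \<open>auto simp: s_def\<close>)
  have mono_div: "w / (2 * t') \<le> w / (2 * t)" if "0 \<le> w" "0 < t" "t \<le> t'" for w t t' :: real
    using that by (intro divide_left_mono) auto
  have "\<exists>C. \<forall>n. (\<Sum>k<n. \<gamma> k) \<le> C"
  proof (rule energy_recursion_bound[OF _ _ _ _ _ _ _ K D])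
    fix k
    have "\<gamma> k + (wnorm_sq S (ys - yb (Suc k)) / (2 * tau k)
        + wnorm_sq (transpose A ** R ** A) (xs - x (Suc k)) / (2 * lam k)) \<le> E k + e k + s k * a (Suc k)"
      using inexact_primal_dual_step[OF f(1) g R S tau lam eps RS xs ys s1 s2 s3, of k]
      by (simp add: \<gamma>_def L_def F_def G_def E_def e_def s_def a_def)
    \<comment> \<open>The step bounds the new distances divided by the old step sizes; passing to
      the larger new ones only decreases the energy.\<close>
    moreover have "E (Suc k) \<le> wnorm_sq S (ys - yb (Suc k)) / (2 * tau k)
        + wnorm_sq (transpose A ** R ** A) (xs - x (Suc k)) / (2 * lam k)"
      unfolding E_def using tau lam tau_mono lam_mono
      by (intro add_mono mono_div wnorm_sq_nonneg S M) (auto simp: mono_iff_le_Suc)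
    ultimately show "\<gamma> k + E (Suc k) \<le> E k + e k + s k * a (Suc k)" by linarith
    show "0 \<le> \<gamma> k" using nonneg[OF x y] by (simp add: \<gamma>_def)
    have nnE: "0 \<le> wnorm_sq (transpose A ** R ** A) (xs - x k) / (2 * lam k)"
      "0 \<le> wnorm_sq S (ys - yb k) / (2 * tau k)"
      using wnorm_sq_nonneg[OF S] wnorm_sq_nonneg[OF M] tau[of k] lam[of k] by auto
    then show E0: "0 \<le> E k" by (simp add: E_def)
    show "0 \<le> s k" by (rule s0)
    show "0 \<le> a k" using wnorm_sq_nonneg[OF S] by (simp add: a_def)
    \<comment> \<open>The recursion lemma needs a constant independent of \<open>k\<close>; the
      uniform bound \<open>taubar\<close> supplies \<open>2 * taubar\<close>.\<close>
    have "wnorm_sq S (ys - yb k) = 2 * tau k * (wnorm_sq S (ys - yb k) / (2 * tau k))"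
      using tau[of k] by simp
    also have "\<dots> \<le> 2 * tau k * E k"
      using tau[of k] nnE by (intro mult_left_mono) (auto simp: E_def)
    also have "\<dots> \<le> 2 * taubar * E k"
      using taubar[of k] E0 by (intro mult_right_mono) auto
    finally show "(a k)\<^sup>2 \<le> 2 * taubar * E k"
      using wnorm_sq_nonneg[OF S] by (simp add: a_def)
  next
    show "0 \<le> 2 * taubar" using taubar[of 0] tau[of 0] by simp
  qed
  then obtain C where C: "\<And>n. (\<Sum>k<n. \<gamma> k) \<le> C" by blast
  define \<Gamma> where "\<Gamma> = (\<lambda>N. L (ergodic_mean x N) ys - L xs (ergodic_mean y N))"
  have fcvx: "convex_on (edom f) F" and gcvx: "convex_on (edom g) G"
    unfolding F_def G_def using convex_on_real_of_ereal f g by auto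
  note mx = convex_on_ergodic_mean[where z = x, OF fcvx x]
    and my = convex_on_ergodic_mean[where z = y, OF gcvx y]
  have gap: "gap N = ereal (\<Gamma> N)" if "N \<ge> 1" for N
    using mx(1) my(1) xs ys that by (simp add: gap_def \<Gamma>_def L)
  have bound: "norm (\<Gamma> N) \<le> C * norm (1 / real N)" if N: "N \<ge> 1" for N
  proof -
    have "0 \<le> \<Gamma> N" using nonneg mx(1) my(1) N by (simp add: \<Gamma>_def)
    \<comment> \<open>Jensen's inequality handles \<open>F\<close> and \<open>G\<close>; the
      coupling terms are linear in the averaged argument, so they average exactly.\<close>
    moreover have "\<Gamma> N \<le> (1 / real N) * (\<Sum>k<N. \<gamma> k)"
    proof -
      have "(A *v ergodic_mean x N) \<bullet> ys = (1 / real N) * (\<Sum>k<N. (A *v x (Suc k)) \<bullet> ys)"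
        by (simp add: ergodic_mean_def matrix_vector_mult_scaleR linear_sum inner_sum_left sum_divide_distrib)
      moreover have "(A *v xs) \<bullet> ergodic_mean y N = (1 / real N) * (\<Sum>k<N. (A *v xs) \<bullet> y (Suc k))"
        by (simp add: ergodic_mean_def inner_sum_right)
      moreover have "(1 / real N) * (\<Sum>k<N. \<gamma> k) = (1 / real N) * (\<Sum>k<N. F (x (Suc k)))
          + (1 / real N) * (\<Sum>k<N. (A *v x (Suc k)) \<bullet> ys) - G ys
          - F xs - (1 / real N) * (\<Sum>k<N. (A *v xs) \<bullet> y (Suc k)) + (1 / real N) * (\<Sum>k<N. G (y (Suc k)))"
        using N by (simp add: \<gamma>_def L_def sum.distrib sum_subtractf field_simps)
      ultimately show ?thesis
        using mx(2)[OF N] my(2)[OF N] by (simp add: \<Gamma>_def L_def)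
    qed
    moreover have "(1 / real N) * (\<Sum>k<N. \<gamma> k) \<le> (1 / real N) * C"
      using C by (intro mult_left_mono) auto
    ultimately show ?thesis by (simp add: mult.commute)
  qed
  \<comment> \<open>\<open>N = 0\<close> is excluded because the mean is then the zero vector,
    possibly outside the domains.\<close>
  have O: "(\<lambda>N. real_of_ereal (gap N)) \<in> O(\<lambda>N. 1 / real N)"
    by (rule bigoI[of _ C], rule eventually_sequentiallyI[of 1]) (use bound in \<open>simp add: gap\<close>)
  have "(\<lambda>N. real_of_ereal (gap N)) \<in> O(\<lambda>N. (ln (real N))\<^sup>2 / real N)"
    using O by (rule landau_o.big_trans) real_asymp
  \<comment> \<open>Here \<open>2 * \<alpha> < 1\<close>, so \<open>1 / N\<close> decays faster than
    the claimed power.\<close>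
  moreover have "(\<lambda>N. real_of_ereal (gap N)) \<in> O(\<lambda>N. real N powr (- (2 * \<alpha>)))" if "\<alpha> < 1/2"
    using O
  proof (rule landau_o.big_trans)
    show "(\<lambda>N. 1 / real N) \<in> O(\<lambda>N. real N powr (- (2 * \<alpha>)))"
      using that by real_asymp
  qed
  ultimately show ?thesis using O gap by simp
qed

end
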